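(* Let $p$ be an odd prime. Then $$\sum_{k=1}^{p-1}2^{k}C_k^{(2)}\equiv 2\left((-1)^{(p-1)/2}-1\right) \pmod p$$ and $$\sum_{k=1}^{p-1} \frac{2^{k}C_k^{(2)}}{k} \equiv 4\left(1-(-1)^{(p-1)/2}\right)\pmod p.$$
   Context: For $k\in\mathbb{N}=\{0,1,2,\ldots\}$, $C_k^{(2)}=\frac{1}{2k+1}\binom{3k}{k}=\binom{3k}{k}-2\binom{3k}{k-1}$ denotes the $k$th Catalan number of order 2 (an integer), where $\binom{x}{-1}$ is regarded as $0$. Congruences modulo $p$ between rational numbers whose denominators are prime to $p$ are understood in the ring of rationals with denominator prime to $p$ (i.e. $a\equiv b \pmod p$ means that $a-b$ is $p$ times such a rational). *)

theory Defs
  imports Complex_Main "HOL-Computational_Algebra.Primes"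
begin

text \<open>Catalan numbers of order 2, as rationals; they are integers by the lemmas below.\<close>

definition catalan2 :: "nat \<Rightarrow> rat" where
  "catalan2 k = 1 / of_nat (2 * k + 1) * of_nat ((3 * k) choose k)"

text \<open>The convention that the binomial coefficient with lower index \<open>-1\<close> vanishes is the
  case \<open>k = 0\<close>.\<close>

lemma catalan2_eq_diff:
  "catalan2 k = of_nat ((3 * k) choose k)
     - 2 * (if k = 0 then 0 else of_nat ((3 * k) choose (k - 1)))"
proof (cases k)
  case 0
  then show ?thesis by (simp add: catalan2_def)
next
  case (Suc j)
  have "k * ((3 * k) choose k) = (2 * k + 1) * ((3 * k) choose (k - 1))"
  proof -
    have "Suc (j + 2 * k) = 3 * k"
      using Suc by simp
    then show ?thesis
      using Suc_times_binomial_add[of j "2 * k"] Suc by (metis Suc_eq_plus1 diff_Suc_1)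
  qed
  then have "(of_nat k * of_nat ((3 * k) choose k) :: rat)
      = of_nat (2 * k + 1) * of_nat ((3 * k) choose (k - 1))"
    by (metis of_nat_mult)
  moreover have "(of_nat (2 * k + 1) :: rat) \<noteq> 0"
    by (metis Suc_eq_plus1 of_nat_eq_0_iff nat.distinct(1))
  ultimately show ?thesis
    using Suc unfolding catalan2_def by (simp add: field_simps del: binomial_Suc_Suc)
qed

lemma catalan2_in_Ints: "catalan2 k \<in> \<int>"
  unfolding catalan2_eq_diff by simp

text \<open>The ring of rationals whose denominator (in lowest terms) is prime to \<open>p\<close>, and
  congruence modulo \<open>p\<close> between elements of this ring.\<close>

definition p_integral :: "nat \<Rightarrow> rat set" where
  "p_integral p = {x. coprime (snd (quotient_of x)) (int p)}"

definition rat_cong :: "nat \<Rightarrow> rat \<Rightarrow> rat \<Rightarrow> bool" where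
  "rat_cong p a b \<longleftrightarrow> a \<in> p_integral p \<and> b \<in> p_integral p \<and>
     (\<exists>r \<in> p_integral p. a - b = of_nat p * r)"

end

theory Submission
  imports Defs "HOL-Computational_Algebra.Polynomial" "HOL-Number_Theory.Cong"
begin

text \<open>
  Put \<open>R = 2(1 + t)\<^sup>3 - t = (2 + t) Q\<close> with \<open>Q = 1 + 2t + 2t\<^sup>2\<close>. Expanding \<open>R\<^sup>n\<close> binomially, the
  coefficient of \<open>t\<^sup>n\<close> in \<open>(1 - 2t) R\<^sup>n\<close> is the sum over \<open>k\<close> of \<open>(n choose k) (-1)\<close> to the
  \<open>n - k\<close> times \<open>2\<close> to the \<open>k\<close> times the Catalan number. For \<open>n = p - 1\<close> the binomial coefficient
  cancels the sign modulo \<open>p\<close>, so the first sum is a coefficient of \<open>(1 - 2t) R\<^sup>n\<close>, which partial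
  fractions reduce to coefficients of powers of \<open>2 + t\<close> and of \<open>Q\<close>. As \<open>Q\<close> splits over
  the Gaussian integers, the latter are coordinates of powers of \<open>1 + \<i>\<close>, and the \<open>p\<close>-th power
  of \<open>1 + \<i>\<close> is congruent to \<open>1 + \<i>\<^sup>p\<close>.

  Since the Catalan number divided by \<open>k\<close> is \<open>(3k choose k) / k\<close> minus twice the Catalan number,
  the second congruence says that the sum of \<open>2\<^sup>k (3k choose k) / k\<close> vanishes modulo \<open>p\<close>. Up to a
  multiple of \<open>p\<^sup>2\<close>, \<open>p\<close> times this sum is read off from the coefficient of \<open>t\<^sup>p\<close> in \<open>R\<^sup>p\<close>, and
  equals \<open>2(2A + 1)(A - 1)\<^sup>2\<close>, where \<open>A\<close> is the real part of the \<open>p\<close>-th power of \<open>1 + \<i>\<close>;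
  finally \<open>p\<close> divides \<open>A - 1\<close>.
\<close>

section \<open>Rationals with denominator prime to \<open>p\<close>\<close>

lemma snd_quotient_of_dvd:
  assumes "b \<noteq> 0" "x = of_int a / of_int b"
  shows "snd (quotient_of x) dvd b"
proof -
  obtain c d where q: "quotient_of x = (c, d)" by force
  have d: "d > 0" "coprime c d" "x = of_int c / of_int d"
    using quotient_of_denom_pos[OF q] quotient_of_coprime[OF q] quotient_of_div[OF q] by auto
  have "(of_int (a * d) :: rat) = of_int (c * b)"
    using assms d by (simp add: field_simps)
  then have "a * d = c * b" using of_int_eq_iff by blast
  then have "d dvd c * b" by (metis dvd_triv_right)
  then have "d dvd b" using d(2) by (metis coprime_commute coprime_dvd_mult_right_iff)
  then show ?thesis using q by simp
qed

text \<open>The reduced denominator divides every other one, so any fraction with denominator prime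
  to \<open>p\<close> will do, and closure proofs need no lowest terms.\<close>

lemma p_integral_iff:
  "x \<in> p_integral p \<longleftrightarrow> (\<exists>a b. b \<noteq> 0 \<and> coprime b (int p) \<and> x = of_int a / of_int b)"
proof
  assume "x \<in> p_integral p"
  moreover obtain c d where q: "quotient_of x = (c, d)" by force
  ultimately have "d \<noteq> 0 \<and> coprime d (int p) \<and> x = of_int c / of_int d"
    using quotient_of_denom_pos[OF q] quotient_of_div[OF q] by (auto simp: p_integral_def)
  then show "\<exists>a b. b \<noteq> 0 \<and> coprime b (int p) \<and> x = of_int a / of_int b" by blast
next
  assume "\<exists>a b. b \<noteq> 0 \<and> coprime b (int p) \<and> x = of_int a / of_int b"
  then obtain a b where "b \<noteq> 0" "coprime b (int p)" "x = of_int a / of_int b" by blast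
  then show "x \<in> p_integral p"
    using snd_quotient_of_dvd[of b x a] unfolding p_integral_def
    by (auto intro: coprime_divisors[of _ b _ "int p"])
qed

lemma p_integral_of_int [simp]: "of_int a \<in> p_integral p"
  unfolding p_integral_iff by (rule exI[of _ a], rule exI[of _ 1]) simp

lemma p_integral_add:
  assumes "x \<in> p_integral p" "y \<in> p_integral p"
  shows "x + y \<in> p_integral p"
proof -
  obtain a b c d where *: "b \<noteq> 0" "coprime b (int p)" "x = of_int a / of_int b"
    "d \<noteq> 0" "coprime d (int p)" "y = of_int c / of_int d"
    using assms unfolding p_integral_iff by metis
  then have "x + y = of_int (a * d + c * b) / of_int (b * d)" by (simp add: field_simps)
  moreover have "b * d \<noteq> 0" "coprime (b * d) (int p)" using * by auto
  ultimately show ?thesis unfolding p_integral_iff by blast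
qed

lemma p_integral_mult:
  assumes "x \<in> p_integral p" "y \<in> p_integral p"
  shows "x * y \<in> p_integral p"
proof -
  obtain a b c d where *: "b \<noteq> 0" "coprime b (int p)" "x = of_int a / of_int b"
    "d \<noteq> 0" "coprime d (int p)" "y = of_int c / of_int d"
    using assms unfolding p_integral_iff by metis
  then have "x * y = of_int (a * c) / of_int (b * d)" by (simp add: field_simps)
  moreover have "b * d \<noteq> 0" "coprime (b * d) (int p)" using * by auto
  ultimately show ?thesis unfolding p_integral_iff by blast
qed

lemma p_integral_diff:
  assumes "x \<in> p_integral p" "y \<in> p_integral p"
  shows "x - y \<in> p_integral p"
  using p_integral_add[OF assms(1) p_integral_mult[OF p_integral_of_int[of "-1"] assms(2)]] by simp

lemma p_integral_sum:
  assumes "\<And>i. i \<in> S \<Longrightarrow> f i \<in> p_integral p"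
  shows "sum f S \<in> p_integral p"
  using assms
proof (induction S rule: infinite_finite_induct)
  case (insert i S)
  then show ?case by (simp add: p_integral_add)
qed (use p_integral_of_int[of 0] in auto)

lemma p_integral_divide_of_nat:
  assumes "prime p" "0 < k" "k < p"
  shows "of_int a / of_nat k \<in> p_integral p"
proof -
  have "coprime k p" using assms
    by (metis coprime_commute nat_dvd_not_less prime_imp_coprime)
  then show ?thesis unfolding p_integral_iff using assms
    by (intro exI[of _ a] exI[of _ "int k"]) auto
qed

section \<open>Binomial coefficients modulo \<open>p\<close> and modulo its square\<close>

text \<open>The product \<open>i * (n choose i)\<close> is a multiple of \<open>n\<close>, while
  \<open>p\<close> does not divide \<open>i\<close>. Multiples \<open>n\<close> of \<open>p\<close>
  beyond \<open>p\<close> itself occur in the Vandermonde sum for \<open>3 * p\<close>.\<close>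

lemma prime_dvd_binomial:
  fixes p :: nat
  assumes "prime p" "p dvd n" "0 < i" "i < p"
  shows "int p dvd int (n choose i)"
proof -
  have "p dvd i * (n choose i)" using assms times_binomial_minus1_eq[of i n] by simp
  then show ?thesis using assms by (metis int_dvd_int_iff nat_dvd_not_less prime_dvd_mult_iff)
qed

text \<open>By Pascal's rule two neighbours add up to \<open>p choose Suc k\<close>, a multiple of
  \<open>p\<close>, so consecutive values are opposite modulo \<open>p\<close>.\<close>

lemma binomial_prime_pred_cong:
  fixes p :: nat
  assumes "prime p" "k < p"
  shows "[int ((p - 1) choose k) = (- 1) ^ k] (mod int p)"
  using assms(2)
proof (induction k)
  case (Suc k)
  have "p choose Suc k = ((p - 1) choose k) + ((p - 1) choose Suc k)"
    using binomial_Suc_Suc[of "p - 1" k] prime_gt_0_nat[OF assms(1)] by simp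
  moreover have "int p dvd int (p choose Suc k)" using prime_dvd_binomial[of p p "Suc k"] assms Suc by simp
  ultimately have "int p dvd int ((p - 1) choose Suc k) + int ((p - 1) choose k)"
    by (simp add: add.commute)
  moreover have "int p dvd int ((p - 1) choose k) - (-1) ^ k"
    using Suc by (simp add: cong_iff_dvd_diff)
  ultimately have "int p dvd (int ((p - 1) choose Suc k) + int ((p - 1) choose k))
      - (int ((p - 1) choose k) - (-1) ^ k)" by (rule dvd_diff)
  then show ?case by (simp add: cong_iff_dvd_diff)
qed simp

lemma sum_split_ends:
  fixes f :: "nat \<Rightarrow> 'a::comm_monoid_add"
  assumes "0 < n"
  shows "(\<Sum>j\<le>n. f j) = f 0 + f n + (\<Sum>j\<in>{1..<n}. f j)"
proof -
  have "{..n} = insert 0 (insert n {1..<n})" using assms by auto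
  then show ?thesis using assms by (simp add: add.assoc)
qed

text \<open>Meant for convolution sums whose inner terms are divisible by the modulus.\<close>

lemma dvd_sum_split_ends:
  fixes f :: "nat \<Rightarrow> int"
  assumes "0 < n" "\<And>j. 0 < j \<Longrightarrow> j < n \<Longrightarrow> d dvd f j"
  shows "[(\<Sum>j\<le>n. f j) = f 0 + f n] (mod d)"
  unfolding sum_split_ends[OF assms(1)] cong_iff_dvd_diff
  using assms(2) by (auto intro!: dvd_sum)

text \<open>In Vandermonde's convolution both factors of an inner term are divisible by
  \<open>p\<close>, so only the two ends count modulo the square.\<close>

lemma binomial_add_prime_cong:
  fixes p :: nat
  assumes p: "prime p" and "p dvd m"
  shows "[int ((p + m) choose p) = int (m choose p) + 1] (mod (int p)^2)"
proof -
  have "int ((p + m) choose p) = (\<Sum>k\<le>p. int (p choose k) * int (m choose (p - k)))"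
    by (subst vandermonde[symmetric]) simp
  also have "[\<dots> = int (p choose 0) * int (m choose (p - 0)) + int (p choose p) * int (m choose (p - p))]
     (mod (int p)^2)"
    using assms prime_gt_0_nat[OF p]
    by (intro dvd_sum_split_ends)
      (auto simp: power2_eq_square intro!: mult_dvd_mono prime_dvd_binomial)
  finally show ?thesis by simp
qed

lemma binomial_3p_cong:
  assumes p: "prime p"
  shows "[int ((3 * p) choose p) = 3] (mod (int p)^2)"
proof -
  have "[int ((p + 2 * p) choose p) = int ((p + p) choose p) + 1] (mod (int p)^2)"
    using binomial_add_prime_cong[OF p, of "2 * p"] by (simp add: mult_2)
  also have "[int ((p + p) choose p) + 1 = (int (p choose p) + 1) + 1] (mod (int p)^2)"
    by (intro cong_add binomial_add_prime_cong[OF p]) auto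
  finally show ?thesis by (simp add: mult.commute)
qed

section \<open>Gaussian integers\<close>

definition gauss_ints :: "complex set" where "gauss_ints = {z. Re z \<in> \<int> \<and> Im z \<in> \<int>}"

lemma gauss_of_int: "of_int a \<in> gauss_ints" and gauss_of_nat: "of_nat n \<in> gauss_ints"
  and gauss_i: "\<i> \<in> gauss_ints" and gauss_1: "1 \<in> gauss_ints" and gauss_0: "0 \<in> gauss_ints"
  by (auto simp: gauss_ints_def)

lemma gauss_add: "x \<in> gauss_ints \<Longrightarrow> y \<in> gauss_ints \<Longrightarrow> x + y \<in> gauss_ints"
  and gauss_diff: "x \<in> gauss_ints \<Longrightarrow> y \<in> gauss_ints \<Longrightarrow> x - y \<in> gauss_ints"
  and gauss_mult: "x \<in> gauss_ints \<Longrightarrow> y \<in> gauss_ints \<Longrightarrow> x * y \<in> gauss_ints"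
  by (auto simp: gauss_ints_def)

lemma gauss_power: "x \<in> gauss_ints \<Longrightarrow> x ^ n \<in> gauss_ints"
  by (induction n) (auto intro: gauss_mult gauss_1)

lemma gauss_sum: "(\<And>i. i \<in> S \<Longrightarrow> f i \<in> gauss_ints) \<Longrightarrow> sum f S \<in> gauss_ints"
  by (induction S rule: infinite_finite_induct) (auto intro: gauss_add gauss_0)

text \<open>Comparing real parts brings an identity over the Gaussian integers back to the
  integers.\<close>

lemma int_dvd_of_gauss:
  assumes "of_int m = of_int n * z" "z \<in> gauss_ints"
  shows "n dvd m"
proof -
  obtain k where "Re z = of_int k" using assms(2) by (auto simp: gauss_ints_def elim: Ints_cases)
  moreover have "Re (of_int m :: complex) = of_int n * Re z" using assms(1) by simp
  ultimately have "(of_int m :: real) = of_int (n * k)" by simp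
  then show ?thesis by (metis dvd_triv_left of_int_eq_iff)
qed

section \<open>Coefficients of powers of linear polynomials and of
  \<open>[:1, 2, 2:]\<close>\<close>

text \<open>Lets an integer polynomial be factored over the complex numbers before its coefficients
  are read off.\<close>

lemma coeff_of_int_power:
  fixes q :: "int poly"
  shows "of_int (coeff (q ^ n) m) = coeff ((map_poly of_int q :: 'a::comm_ring_1 poly) ^ n) m"
proof (induction n arbitrary: m)
  case 0
  show ?case by (cases m) auto
next
  case (Suc n)
  then show ?case by (simp add: coeff_mult coeff_map_poly)
qed

lemma coeff_one_linear_power:
  fixes b :: "'a::comm_semiring_1"
  shows "coeff ([:1, b:] ^ n) i = of_nat (n choose i) * b ^ i"
proof (cases "i \<le> n")
  case False
  moreover have "degree ([:1, b:] ^ n) \<le> n"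
    using degree_power_le[of "[:1, b:]" n] by (auto split: if_splits)
  ultimately show ?thesis by (simp add: coeff_eq_0 binomial_eq_0)
qed (simp add: coeff_linear_poly_power)

text \<open>The product formula behind this is \<open>1 + 2t + 2t\<^sup>2 = (1 + (1 + \<i>)t)(1 + (1 - \<i>)t)\<close>.\<close>

lemma coeff_quadratic_power:
  "(of_int (coeff ([:1, 2, 2:] ^ n) m) :: complex) =
    (\<Sum>j\<le>m. of_nat ((n choose j) * (n choose (m - j))) * ((1 + \<i>) ^ j * (1 - \<i>) ^ (m - j)))"
proof -
  have "(map_poly of_int [:1, 2, 2:] :: complex poly) = [:1, 1 + \<i>:] * [:1, 1 - \<i>:]"
    by (simp add: map_poly_pCons algebra_simps)
  then show ?thesis
    unfolding coeff_of_int_power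
    by (simp only: power_mult_distrib coeff_mult coeff_one_linear_power of_nat_mult) (simp only: mult_ac)
qed

lemma gauss_one_plus_i_powers: "(1 + \<i>) ^ j * (1 - \<i>) ^ k \<in> gauss_ints"
  by (intro gauss_mult gauss_power gauss_add gauss_diff gauss_1 gauss_i)

text \<open>In each term \<open>j\<close> and \<open>m - j\<close> are below \<open>p\<close> and
  not both zero, so one of the two binomial coefficients is divisible by \<open>p\<close>.\<close>

lemma coeff_quadratic_power_prime_dvd:
  assumes p: "prime p" and "0 < m" "m < p"
  shows "int p dvd coeff ([:1, 2, 2:] ^ p) m"
proof -
  have "\<exists>z\<in>gauss_ints. of_nat ((p choose j) * (p choose (m - j))) * ((1 + \<i>) ^ j * (1 - \<i>) ^ (m - j))
     = of_nat p * z" if "j \<le> m" for j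
  proof -
    have "int p dvd int (p choose j) \<or> int p dvd int (p choose (m - j))"
      using prime_dvd_binomial[OF p, of p j] prime_dvd_binomial[OF p, of p "m - j"] assms that
      by (cases "j = 0") auto
    then have "p dvd (p choose j) * (p choose (m - j))"
      by auto
    then obtain c where "(p choose j) * (p choose (m - j)) = p * c" by blast
    then show ?thesis
      by (intro bexI[of _ "of_nat c * ((1 + \<i>) ^ j * (1 - \<i>) ^ (m - j))"])
        (auto intro: gauss_one_plus_i_powers gauss_mult gauss_of_nat simp: mult.assoc simp del: of_nat_mult simp flip: of_nat_mult)
  qed
  then obtain z where z: "\<And>j. j \<le> m \<Longrightarrow> z j \<in> gauss_ints"
    "\<And>j. j \<le> m \<Longrightarrow> of_nat ((p choose j) * (p choose (m - j))) * ((1 + \<i>) ^ j * (1 - \<i>) ^ (m - j))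
     = of_nat p * z j" by metis
  have "of_int (coeff ([:1, 2, 2:] ^ p) m) = of_int (int p) * (\<Sum>j\<le>m. z j)"
    unfolding coeff_quadratic_power sum_distrib_left by (intro sum.cong refl) (simp add: z(2) del: of_nat_mult)
  then show ?thesis by (rule int_dvd_of_gauss) (auto intro: gauss_sum z)
qed

lemma gauss_coordsE:
  assumes "z \<in> gauss_ints"
  obtains A B :: int where "z = of_int A + of_int B * \<i>"
  using assms by (auto simp: gauss_ints_def complex_eq_iff elim!: Ints_cases)

lemma one_plus_i_power_coordsE:
  obtains A B :: int where "(1 + \<i>) ^ n = of_int A + of_int B * \<i>"
  using gauss_one_plus_i_powers[of n 0] by (auto elim: gauss_coordsE)

text \<open>In an inner term the two binomial coefficients agree and are both divisible by
  \<open>p\<close>, which gives the square. The two end terms are conjugate and add up to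
  \<open>2 * A\<close>.\<close>

lemma coeff_quadratic_power_prime:
  assumes p: "prime p" and AB: "(1 + \<i>) ^ p = of_int A + of_int B * \<i>"
  shows "[coeff ([:1, 2, 2:] ^ p) p = 2 * A] (mod (int p)^2)"
proof -
  have p0: "0 < p" using prime_gt_0_nat[OF p] .
  define z where "z j = (of_nat (((p choose j) div p)^2) * ((1 + \<i>) ^ j * (1 - \<i>) ^ (p - j)) :: complex)" for j
  have z: "of_nat ((p choose j) * (p choose (p - j))) * ((1 + \<i>) ^ j * (1 - \<i>) ^ (p - j)) = (of_nat p)^2 * z j"
    if j: "j \<in> {1..<p}" for j
  proof -
    have "int p dvd int (p choose j)" using prime_dvd_binomial[OF p, of p j] j by simp
    then obtain c where c: "p choose j = p * c" by auto
    moreover have "p choose (p - j) = p choose j" using j by (subst binomial_symmetric) auto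
    ultimately show ?thesis using p0 by (simp add: z_def power2_eq_square mult_ac)
  qed
  have "cnj ((1 + \<i>) ^ p) = of_int A - of_int B * \<i>" unfolding AB by simp
  then have AB': "(1 - \<i>) ^ p = of_int A - of_int B * \<i>" by simp
  have "of_int (coeff ([:1, 2, 2:] ^ p) p - 2 * A) = of_int ((int p)^2) * (\<Sum>j\<in>{1..<p}. z j)"
    unfolding of_int_diff coeff_quadratic_power sum_split_ends[OF p0] sum_distrib_left
    using z by (simp add: AB AB' del: of_nat_mult)
  then have "(int p)^2 dvd coeff ([:1, 2, 2:] ^ p) p - 2 * A"
    by (rule int_dvd_of_gauss)
      (auto simp: z_def intro!: gauss_sum gauss_mult[OF gauss_of_nat] gauss_one_plus_i_powers simp del: of_nat_power)
  then show ?thesis by (simp add: cong_iff_dvd_diff)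
qed

text \<open>Every product of binomial coefficients is congruent to \<open>(- 1) ^ (p - 2)\<close>,
  which is -1 for odd \<open>p\<close>. What remains is minus the sum from the factorization of a
  difference of powers.\<close>

lemma coeff_quadratic_power_pred:
  assumes p: "prime p" "odd p" and AB: "(1 + \<i>) ^ (p - 1) = of_int A + of_int B * \<i>"
  shows "[coeff ([:1, 2, 2:] ^ (p - 1)) (p - 2) = - B] (mod (int p))"
proof -
  have p3: "p \<ge> 3" using p prime_ge_2_nat[of p] by (cases "p = 2") auto
  let ?w = "\<lambda>j. (1 + \<i>) ^ j * (1 - \<i>) ^ (p - 2 - j)"
  have "\<exists>c. int (((p - 1) choose j) * ((p - 1) choose (p - 2 - j))) + 1 = int p * c" if "j \<le> p - 2" for j
  proof -
    have "[int ((p - 1) choose j) * int ((p - 1) choose (p - 2 - j)) = (-1) ^ j * (-1) ^ (p - 2 - j)] (mod int p)"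
      by (intro cong_mult binomial_prime_pred_cong) (use p p3 that in auto)
    also have "(-1) ^ j * (-1) ^ (p - 2 - j) = (-1::int) ^ (p - 2)"
      using that by (metis le_add_diff_inverse power_add)
    also have "\<dots> = - 1" using p p3 by simp
    finally show ?thesis by (auto simp: cong_iff_dvd_diff)
  qed
  then obtain c where c: "\<And>j. j \<le> p - 2 \<Longrightarrow>
    int (((p - 1) choose j) * ((p - 1) choose (p - 2 - j))) + 1 = int p * c j" by metis
  have c': "of_nat (((p - 1) choose j) * ((p - 1) choose (p - 2 - j))) = (of_nat p * of_int (c j) - 1 :: complex)"
    if "j \<le> p - 2" for j
    using arg_cong[OF c[OF that], of "of_int :: int \<Rightarrow> complex"] by (simp add: algebra_simps)
  have "cnj ((1 + \<i>) ^ (p - 1)) = of_int A - of_int B * \<i>" unfolding AB by simp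
  then have AB': "(1 - \<i>) ^ (p - 1) = of_int A - of_int B * \<i>" by simp
  have Sp: "Suc (p - 2) = p - 1" using p3 by simp
  \<comment> \<open>The left side is \<open>2 * B * \<i>\<close> and the first factor on the right
    is \<open>2 * \<i>\<close>, so the sum equals \<open>B\<close>.\<close>
  have "(1 + \<i>) ^ (p - 1) - (1 - \<i>) ^ (p - 1) = (1 + \<i> - (1 - \<i>)) * (\<Sum>j\<le>p - 2. ?w j)"
    using diff_power_eq_sum[of "1 + \<i>" "p - 2" "1 - \<i>"] unfolding lessThan_Suc_atMost unfolding Sp .
  then have B: "(\<Sum>j\<le>p - 2. ?w j) = of_int B" unfolding AB AB' by simp
  have "of_int (coeff ([:1, 2, 2:] ^ (p - 1)) (p - 2)) = (\<Sum>j\<le>p - 2. (of_nat p * of_int (c j) - 1) * ?w j)"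
    unfolding coeff_quadratic_power by (intro sum.cong refl) (simp only: c' atMost_iff)
  also have "\<dots> = of_nat p * (\<Sum>j\<le>p - 2. of_int (c j) * ?w j) - of_int B"
    unfolding B[symmetric] sum_distrib_left sum_subtractf[symmetric] by (intro sum.cong refl) (simp add: algebra_simps)
  finally have "of_int (coeff ([:1, 2, 2:] ^ (p - 1)) (p - 2) - (- B)) = of_int (int p) * (\<Sum>j\<le>p - 2. of_int (c j) * ?w j)"
    by simp
  then show ?thesis unfolding cong_iff_dvd_diff
    by (rule int_dvd_of_gauss) (intro gauss_sum gauss_mult[OF gauss_of_int] gauss_one_plus_i_powers)
qed

section \<open>Coordinates of powers of \<open>1 + \<i>\<close>\<close>

text \<open>The inner binomial coefficients are multiples of \<open>p\<close>, so the power is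
  \<open>1 + \<i> ^ p\<close> plus \<open>p\<close> times a Gaussian integer; the coordinates are
  then compared.\<close>

lemma one_plus_i_power_prime_cong:
  assumes p: "prime p" "odd p" and AB: "(1 + \<i>) ^ p = of_int A + of_int B * \<i>"
  shows "[A = 1] (mod int p)" "[B = (- 1) ^ ((p - 1) div 2)] (mod int p)"
proof -
  have p0: "0 < p" using prime_gt_0_nat p by blast
  define e :: int where "e = (- 1) ^ ((p - 1) div 2)"
  have "\<i> ^ p = \<i> ^ (2 * ((p - 1) div 2) + 1)" using p by simp
  also have "\<dots> = of_int e * \<i>" unfolding power_add power_mult e_def by simp
  finally have ip: "\<i> ^ p = of_int e * \<i>" .
  define z where "z = (\<Sum>k\<in>{1..<p}. of_nat ((p choose k) div p) * \<i> ^ k)"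
  have z: "z \<in> gauss_ints" unfolding z_def
    by (intro gauss_sum gauss_mult gauss_of_nat gauss_power gauss_i)
  have "(\<i> + 1) ^ p = 1 + of_int e * \<i> + (\<Sum>k\<in>{1..<p}. of_nat (p choose k) * \<i> ^ k)"
    unfolding binomial_ring sum_split_ends[OF p0] by (simp add: ip)
  also have "(\<Sum>k\<in>{1..<p}. of_nat (p choose k) * \<i> ^ k) = of_nat p * z"
    unfolding z_def sum_distrib_left
  proof (intro sum.cong refl)
    fix k assume "k \<in> {1..<p}"
    then have "int p dvd int (p choose k)" using prime_dvd_binomial[OF p(1), of p k] by simp
    then obtain c where "p choose k = p * c" by auto
    then show "of_nat (p choose k) * \<i> ^ k = of_nat p * (of_nat ((p choose k) div p) * \<i> ^ k)"
      using p0 by simp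
  qed
  finally have eq: "of_int (A - 1) + of_int (B - e) * \<i> = of_nat p * z"
    using AB by (simp add: add.commute algebra_simps)
  obtain C D where "z = of_int C + of_int D * \<i>" using gauss_coordsE[OF z] .
  with eq have "(of_int (A - 1) :: real) = of_int (int p * C)" "(of_int (B - e) :: real) = of_int (int p * D)"
    by (simp_all add: complex_eq_iff)
  then have "A - 1 = int p * C" "B - e = int p * D" unfolding of_int_eq_iff by auto
  then show "[A = 1] (mod int p)" "[B = (- 1) ^ ((p - 1) div 2)] (mod int p)"
    by (simp_all add: cong_iff_dvd_diff e_def)
qed

text \<open>Since the square of \<open>1 + \<i>\<close> is \<open>2 * \<i>\<close>, the power for
  \<open>n = 2 * m + 1\<close> is \<open>2 ^ m * \<i> ^ m * (1 + \<i>)\<close>, with real part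
  \<open>2 ^ m\<close> up to sign. This trades powers of 2 for squares of \<open>A\<close>.\<close>

lemma one_plus_i_power_odd_Re_square:
  assumes "odd n" and AB: "(1 + \<i>) ^ n = of_int A + of_int B * \<i>"
  shows "A ^ 2 = 2 ^ (n - 1)"
proof -
  obtain m where m: "n = 2 * m + 1" using assms(1) by (auto elim: oddE)
  have s: "(1 + \<i>) ^ 2 = 2 * \<i>" by (simp add: power2_eq_square algebra_simps)
  have i: "\<i> ^ m = 1 \<or> \<i> ^ m = - 1 \<or> \<i> ^ m = \<i> \<or> \<i> ^ m = - \<i>"
    by (induction m) auto
  have "(1 + \<i>) ^ n = 2 ^ m * (\<i> ^ m * (1 + \<i>))"
    unfolding m power_add power_mult s power_mult_distrib by simp
  then have "of_int A + of_int B * \<i> = of_int (2 ^ m) * (\<i> ^ m * (1 + \<i>))" using AB by simp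
  then have "(of_int A :: real) = of_int (2 ^ m) \<or> (of_int A :: real) = of_int (- (2 ^ m))"
    using i by (elim disjE) (simp_all add: complex_eq_iff del: of_int_power)
  then have "A = 2 ^ m \<or> A = - (2 ^ m)" unfolding of_int_eq_iff .
  then have "A ^ 2 = (2 ^ m) ^ 2" by auto
  then show ?thesis by (simp add: m power_mult[symmetric] mult.commute)
qed

section \<open>Coefficients of powers of \<open>[:2, 5, 6, 2:]\<close>\<close>

text \<open>Here \<open>2 + 5t + 6t\<^sup>2 + 2t\<^sup>3 = 2(1 + t)\<^sup>3 - t\<close>.\<close>

lemma coeff_cubic_power:
  "coeff ([:2, 5, 6, 2:] ^ n :: int poly) m =
    (\<Sum>k\<le>n. int (n choose k) * 2 ^ k * (- 1) ^ (n - k) *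
       (if m < n - k then 0 else int ((3 * k) choose (m - (n - k)))))"
proof -
  have "[:2, 5, 6, 2:] = smult 2 ([:1, 1:] ^ 3) + (monom (- 1) 1 :: int poly)"
    by (simp add: eval_nat_numeral monom_Suc monom_0)
  then have 1: "coeff ([:2, 5, 6, 2:] ^ n :: int poly) m = (\<Sum>k\<le>n. coeff (of_nat (n choose k) *
      (smult 2 ([:1, 1:] ^ 3)) ^ k * (monom (- 1) 1 :: int poly) ^ (n - k)) m)"
    by (simp only: binomial_ring coeff_sum)
  have 2: "of_nat (n choose k) * (smult 2 ([:1, 1:] ^ 3)) ^ k * (monom (- 1) 1 :: int poly) ^ (n - k)
      = smult (int (n choose k) * 2 ^ k) (monom ((- 1) ^ (n - k)) (n - k) * [:1, 1:] ^ (3 * k))" for k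
    by (simp add: of_nat_poly smult_power monom_power mult_ac flip: power_mult)
  show ?thesis unfolding 1 2 by (simp add: coeff_monom_mult coeff_one_linear_power mult_ac if_distrib cong: if_cong)
qed

lemma coeff_cubic_power_diag:
  "coeff ([:2, 5, 6, 2:] ^ n :: int poly) n =
    (\<Sum>k\<le>n. int (n choose k) * 2 ^ k * (- 1) ^ (n - k) * int ((3 * k) choose k))"
  unfolding coeff_cubic_power by (intro sum.cong) auto

text \<open>The difference form stays inside the integers, where sums can be reduced modulo
  \<open>p\<close> directly.\<close>

definition catalan2_int :: "nat \<Rightarrow> int" where
  "catalan2_int k = int ((3 * k) choose k) - 2 * (if k = 0 then 0 else int ((3 * k) choose (k - 1)))"

lemma of_int_catalan2_int: "of_int (catalan2_int k) = catalan2 k"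
  by (simp add: catalan2_int_def catalan2_eq_diff)

text \<open>The linear factor subtracts twice the coefficient of index \<open>n - 1\<close>, which
  lowers each binomial index from \<open>k\<close> to \<open>k - 1\<close> and so produces the
  difference form.\<close>

lemma coeff_cubic_power_catalan2:
  assumes "0 < n"
  shows "coeff ([:1, - 2:] * [:2, 5, 6, 2:] ^ n :: int poly) n =
    (\<Sum>k\<le>n. int (n choose k) * 2 ^ k * (- 1) ^ (n - k) * catalan2_int k)"
proof -
  have "coeff ([:1, - 2:] * [:2, 5, 6, 2:] ^ n :: int poly) n
    = coeff ([:2, 5, 6, 2:] ^ n :: int poly) n - 2 * coeff ([:2, 5, 6, 2:] ^ n :: int poly) (n - 1)"
    using assms by (cases n) (simp_all del: power_Suc)
  \<comment> \<open>At index \<open>n - 1\<close> the condition \<open>m < n - k\<close> means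
    \<open>k = 0\<close>, so the zero case is the convention for lower index -1.\<close>
  also have "coeff ([:2, 5, 6, 2:] ^ n :: int poly) (n - 1) =  (\<Sum>k\<le>n. int (n choose k) * 2 ^ k * (- 1) ^ (n - k) *
     (if k = 0 then 0 else int ((3 * k) choose (k - 1))))"
    unfolding coeff_cubic_power using assms by (intro sum.cong) auto
  finally show ?thesis
    unfolding coeff_cubic_power_diag catalan2_int_def
    by (simp add: sum_distrib_left right_diff_distrib sum_subtractf mult_ac cong: if_cong)
qed

lemma cubic_factor: "[:2, 5, 6, 2:] = [:2, 1:] * ([:1, 2, 2:] :: int poly)"
  by simp

lemma coeff_linear_two_power:
  "i \<le> n \<Longrightarrow> coeff ([:2, 1:] ^ n :: int poly) i = int (n choose i) * 2 ^ (n - i)"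
  by (simp add: coeff_linear_poly_power)

section \<open>The first sum modulo \<open>p\<close>\<close>

lemma sum_catalan2_cong:
  assumes p: "prime p" "odd p"
  shows "[(\<Sum>k = 1..p - 1. 2 ^ k * catalan2_int k) = 2 * ((- 1) ^ ((p - 1) div 2) - 1)] (mod int p)"
proof -
  have p3: "p \<ge> 3" using p prime_ge_2_nat[of p] by (cases "p = 2") auto
  define L where "L = ([:2, 1:] :: int poly)"
  define Q where "Q = ([:1, 2, 2:] :: int poly)"
  define R where "R = ([:2, 5, 6, 2:] :: int poly)"
  define \<epsilon> :: int where "\<epsilon> = (- 1) ^ ((p - 1) div 2)"
  define S where "S = (\<Sum>k = 1..p - 1. 2 ^ k * catalan2_int k)"
  obtain A B where AB: "(1 + \<i>) ^ (p - 1) = of_int A + of_int B * \<i>" using one_plus_i_power_coordsE .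
  have "(1 + \<i>) ^ p = (1 + \<i>) ^ (p - 1) * (1 + \<i>)" using p3 by (simp flip: power_Suc2)
  also have "\<dots> = of_int (A - B) + of_int (A + B) * \<i>" unfolding AB by (simp add: algebra_simps)
  finally have AB': "(1 + \<i>) ^ p = of_int (A - B) + of_int (A + B) * \<i>" .
  note AB'_cong = one_plus_i_power_prime_cong[OF p AB']
  \<comment> \<open>The difference of the two coordinates of the \<open>p\<close>-th power is
    \<open>(A + B) - (A - B)\<close>.\<close>
  have B: "[2 * B = \<epsilon> - 1] (mod int p)"
    using cong_diff[OF AB'_cong(2,1)] unfolding \<epsilon>_def by simp
  \<comment> \<open>Fermat's theorem for base 2: \<open>(A - B) ^ 2\<close> equals
    \<open>2 ^ (p - 1)\<close>, and \<open>A - B\<close> is congruent to 1.\<close>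
  have F: "[2 ^ (p - 1) = (1::int)] (mod int p)"
    using cong_pow[OF AB'_cong(1), of 2] one_plus_i_power_odd_Re_square[OF p(2) AB'] by simp
  have F': "[2 ^ p = (2::int)] (mod int p)"
    using cong_scalar_left[OF F, of 2] p3 by (simp flip: power_Suc)

  \<comment> \<open>The coefficients of \<open>Q ^ p\<close> in degrees 1 to \<open>p - 1\<close>
    vanish modulo \<open>p\<close>. Only the leading coefficient of \<open>L ^ (p - 1)\<close> times
    the constant term of \<open>Q ^ p\<close> survives.\<close>
  have "[coeff (L ^ (p - 1) * Q ^ p) (p - 1) =
      coeff (L ^ (p - 1)) 0 * coeff (Q ^ p) (p - 1) + coeff (L ^ (p - 1)) (p - 1) * coeff (Q ^ p) 0] (mod int p)"
    using dvd_sum_split_ends[of "p - 1" "int p" "\<lambda>j. coeff (L ^ (p - 1)) j * coeff (Q ^ p) (p - 1 - j)"] p3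
      coeff_quadratic_power_prime_dvd[OF p(1)]
    unfolding coeff_mult by (simp add: Q_def)
  also have "[coeff (L ^ (p - 1)) 0 * coeff (Q ^ p) (p - 1) + coeff (L ^ (p - 1)) (p - 1) * coeff (Q ^ p) 0
      = 1] (mod int p)"
    using coeff_quadratic_power_prime_dvd[OF p(1), of "p - 1"] p3
    by (simp add: L_def coeff_linear_power coeff_0_power cong_iff_dvd_diff Q_def)
  finally have 1: "[coeff (L ^ (p - 1) * Q ^ p) (p - 1) = 1] (mod int p)" .

  \<comment> \<open>Now \<open>L ^ p\<close> has the vanishing inner coefficients. Its constant term
    \<open>2 ^ p\<close>, congruent to 2, meets the coefficient \<open>- B\<close>.\<close>
  have "[coeff (L ^ p * Q ^ (p - 1)) (p - 2) =
      coeff (L ^ p) 0 * coeff (Q ^ (p - 1)) (p - 2) + coeff (L ^ p) (p - 2) * coeff (Q ^ (p - 1)) 0] (mod int p)"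
    using dvd_sum_split_ends[of "p - 2" "int p" "\<lambda>j. coeff (L ^ p) j * coeff (Q ^ (p - 1)) (p - 2 - j)"] p3
      prime_dvd_binomial[OF p(1)]
    unfolding coeff_mult by (simp add: L_def coeff_linear_two_power)
  also have "[coeff (L ^ p) 0 * coeff (Q ^ (p - 1)) (p - 2) + coeff (L ^ p) (p - 2) * coeff (Q ^ (p - 1)) 0
      = 2 * (- B) + 0 * 1] (mod int p)"
    using coeff_quadratic_power_pred[OF p AB] p3 F' prime_dvd_binomial[OF p(1), of p "p - 2"]
    by (intro cong_add cong_mult) (auto simp: L_def Q_def coeff_0_power coeff_linear_two_power cong_0_iff)
  finally have 2: "[coeff (L ^ p * Q ^ (p - 1)) (p - 2) = - (2 * B)] (mod int p)" by simp

  have R: "R = L * Q" unfolding R_def L_def Q_def by simp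
  have Sp: "Suc (p - 1) = p" "Suc (p - 2) = p - 1" using p3 by auto
  \<comment> \<open>Clears denominators in the partial fraction decomposition of \<open>(1 - 2t) / R\<close>.\<close>
  have *: "smult 2 [:1, - 2:] = smult 2 Q - pCons 0 (smult 4 L)"
    by (simp add: Q_def L_def)
  have "smult 2 ([:1, - 2:] * R ^ (p - 1)) = (smult 2 Q - pCons 0 (smult 4 L)) * (L ^ (p - 1) * Q ^ (p - 1))"
    unfolding R power_mult_distrib *[symmetric] mult_smult_left ..
  also have "\<dots> = smult 2 (L ^ (p - 1) * (Q * Q ^ (p - 1))) - pCons 0 (smult 4 ((L * L ^ (p - 1)) * Q ^ (p - 1)))"
    by (simp only: left_diff_distrib mult_smult_left mult_pCons_left) (simp add: mult_ac)
  finally have eq: "smult 2 ([:1, - 2:] * R ^ (p - 1)) =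
      smult 2 (L ^ (p - 1) * Q ^ p) - pCons 0 (smult 4 (L ^ p * Q ^ (p - 1)))"
    unfolding power_Suc[symmetric] Sp .
  have "2 * coeff ([:1, - 2:] * R ^ (p - 1)) (p - 1) = 2 * coeff (L ^ (p - 1) * Q ^ p) (p - 1)
      - 4 * coeff (L ^ p * Q ^ (p - 1)) (p - 2)"
    using arg_cong[OF eq, of "\<lambda>q. coeff q (Suc (p - 2))"]
    unfolding coeff_diff coeff_smult coeff_pCons_Suc unfolding Sp .
  also have "[\<dots> = 2 * 1 - 4 * (- (2 * B))] (mod int p)"
    by (intro cong_diff cong_mult 1 2) auto
  also have "2 * 1 - 4 * (- (2 * B)) = 2 + 4 * (2 * B)" by simp
  also have "[\<dots> = 2 + 4 * (\<epsilon> - 1)] (mod int p)" by (intro cong_add cong_mult B) auto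
  also have "2 + 4 * (\<epsilon> - 1) = 2 * (1 + 2 * (\<epsilon> - 1))" by simp
  \<comment> \<open>The factor 2 cancels because \<open>p\<close> is odd. The leading 1 will match
    the term \<open>k = 0\<close> of the sum.\<close>
  finally have 3: "[coeff ([:1, - 2:] * R ^ (p - 1)) (p - 1) = 1 + 2 * (\<epsilon> - 1)] (mod int p)"
    using p by (subst (asm) cong_mult_lcancel) (auto simp: coprime_commute)

  have "coeff ([:1, - 2:] * R ^ (p - 1)) (p - 1) =
     (\<Sum>k\<le>p - 1. int ((p - 1) choose k) * 2 ^ k * (- 1) ^ (p - 1 - k) * catalan2_int k)"
    unfolding R_def using p3 by (intro coeff_cubic_power_catalan2) auto
  also have "[\<dots> = (\<Sum>k\<le>p - 1. (- 1) ^ k * 2 ^ k * (- 1) ^ (p - 1 - k) * catalan2_int k)] (mod int p)"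
    using p3 by (intro cong_sum cong_mult binomial_prime_pred_cong[OF p(1)] cong_refl) auto
  also have "(\<Sum>k\<le>p - 1. (- 1) ^ k * 2 ^ k * (- 1) ^ (p - 1 - k) * catalan2_int k) =
     (\<Sum>k\<le>p - 1. 2 ^ k * catalan2_int k)"
  proof (intro sum.cong refl)
    fix k assume "k \<in> {..p - 1}"
    then have "(- 1) ^ k * (- 1) ^ (p - 1 - k) = (- 1 :: int) ^ (p - 1)"
      by (metis atMost_iff le_add_diff_inverse power_add)
    also have "\<dots> = 1" using p by simp
    finally show "(- 1) ^ k * 2 ^ k * (- 1) ^ (p - 1 - k) * catalan2_int k = 2 ^ k * catalan2_int k"
      by (simp add: mult_ac)
  qed
  also have "\<dots> = 1 + S"
    unfolding S_def atMost_atLeast0 by (subst sum.atLeast_Suc_atMost) (auto simp: catalan2_int_def)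
  finally have "[1 + S = 1 + 2 * (\<epsilon> - 1)] (mod int p)" using 3 by (metis cong_trans cong_sym)
  then show ?thesis unfolding cong_add_lcancel S_def \<epsilon>_def .
qed

section \<open>The sum of \<open>2 ^ k * ((3 * k) choose k) / k\<close> modulo
  \<open>p\<close>\<close>

text \<open>The inner coefficients of \<open>L ^ p\<close> and of \<open>Q ^ p\<close> are each
  divisible by \<open>p\<close>, so their products vanish modulo the square.\<close>

lemma coeff_cubic_power_prime:
  assumes p: "prime p" and AB: "(1 + \<i>) ^ p = of_int A + of_int B * \<i>"
  shows "[coeff ([:2, 5, 6, 2:] ^ p) p = 1 + 2 ^ p * (2 * A)] (mod (int p)^2)"
proof -
  define L where "L = ([:2, 1:] :: int poly)"
  define Q where "Q = ([:1, 2, 2:] :: int poly)"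
  have p0: "0 < p" using prime_gt_0_nat p by blast
  have "coeff ([:2, 5, 6, 2:] ^ p) p = (\<Sum>j\<le>p. coeff (L ^ p) j * coeff (Q ^ p) (p - j))"
    unfolding cubic_factor power_mult_distrib coeff_mult L_def Q_def ..
  also have "[\<dots> = coeff (L ^ p) 0 * coeff (Q ^ p) (p - 0) + coeff (L ^ p) p * coeff (Q ^ p) (p - p)] (mod (int p)^2)"
    using p0 by (intro dvd_sum_split_ends) (auto simp: power2_eq_square L_def Q_def coeff_linear_two_power
      intro!: mult_dvd_mono dvd_mult2[OF prime_dvd_binomial[OF p]] coeff_quadratic_power_prime_dvd[OF p])
  also have "[coeff (L ^ p) 0 * coeff (Q ^ p) (p - 0) + coeff (L ^ p) p * coeff (Q ^ p) (p - p)
      = 2 ^ p * (2 * A) + 1 * 1] (mod (int p)^2)"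
    using coeff_quadratic_power_prime[OF p AB]
    by (intro cong_add cong_mult) (auto simp: L_def Q_def coeff_0_power coeff_linear_power)
  finally show ?thesis by (simp add: add.commute)
qed

text \<open>This is the coefficient of \<open>coeff_cubic_power_prime\<close> stripped of its end
  terms: -1 for \<open>k = 0\<close> and, modulo the square, \<open>2 ^ p * 3\<close> for
  \<open>k = p\<close>.\<close>

lemma alternating_sum_binomial_3k_dvd:
  assumes p: "prime p" "odd p"
  shows "(int p)^2 dvd (\<Sum>k\<in>{1..<p}. int (p choose k) * 2 ^ k * (- 1) ^ (p - k) * int ((3 * k) choose k))"
    (is "_ dvd ?N")
proof -
  have p0: "0 < p" using prime_gt_0_nat p by blast
  obtain A B where AB: "(1 + \<i>) ^ p = of_int A + of_int B * \<i>" using one_plus_i_power_coordsE .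
  have A2: "2 ^ p = 2 * A ^ 2" using one_plus_i_power_odd_Re_square[OF p(2) AB] p0 by (simp flip: power_Suc)
  define N where "N = ?N"
  have "[1 + 2 ^ p * (2 * A) = coeff ([:2, 5, 6, 2:] ^ p) p] (mod (int p)^2)"
    using coeff_cubic_power_prime[OF p(1) AB] by (rule cong_sym)
  also have "coeff ([:2, 5, 6, 2:] ^ p) p = - 1 + 2 ^ p * int ((3 * p) choose p) + N"
    unfolding coeff_cubic_power_diag sum_split_ends[OF p0] N_def using p by simp
  also have "[- 1 + 2 ^ p * int ((3 * p) choose p) + N = - 1 + 2 ^ p * 3 + N] (mod (int p)^2)"
    by (intro cong_add cong_mult cong_refl binomial_3p_cong p)
  finally have "(int p)^2 dvd (1 + 2 ^ p * (2 * A)) - (- 1 + 2 ^ p * 3 + N)"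
    unfolding cong_iff_dvd_diff .
  \<comment> \<open>With \<open>2 ^ p = 2 * A ^ 2\<close> the part without \<open>N\<close> is the
    cubic \<open>4 * A ^ 3 - 6 * A ^ 2 + 2\<close>, which has a double root at 1.\<close>
  also have "(1 + 2 ^ p * (2 * A)) - (- 1 + 2 ^ p * 3 + N) = 2 * (2 * A + 1) * (A - 1) ^ 2 - N"
    unfolding A2 by (simp add: algebra_simps power2_eq_square)
  finally have "(int p)^2 dvd 2 * (2 * A + 1) * (A - 1) ^ 2 - N" .
  moreover have "(int p)^2 dvd 2 * (2 * A + 1) * (A - 1) ^ 2"
    using one_plus_i_power_prime_cong(1)[OF p AB] unfolding cong_iff_dvd_diff
    by (intro dvd_mult dvd_power_same)
  ultimately show ?thesis unfolding N_def by (simp add: dvd_diff_right_iff)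
qed

text \<open>Since \<open>p choose k\<close> is \<open>p / k\<close> times
  \<open>(p - 1) choose (k - 1)\<close>, and the latter cancels the sign modulo \<open>p\<close>,
  the alternating sum is \<open>p\<close> times this one up to a \<open>p\<close>-integral multiple
  of the square of \<open>p\<close>. One factor \<open>p\<close> is then cancelled.\<close>

lemma sum_binomial_3k_over_k:
  assumes p: "prime p" "odd p"
  shows "\<exists>r\<in>p_integral p. (\<Sum>k = 1..p - 1. 2 ^ k * of_nat ((3 * k) choose k) / of_nat k) = of_nat p * r"
proof -
  have p0: "0 < p" using prime_gt_0_nat p by blast
  have "\<exists>c. int ((p - 1) choose (k - 1)) * (- 1) ^ (p - k) = 1 + int p * c" if "k \<in> {1..<p}" for k
  proof -
    have "[int ((p - 1) choose (k - 1)) * (- 1) ^ (p - k) = (- 1) ^ (k - 1) * (- 1) ^ (p - k)] (mod int p)"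
      using that by (intro cong_mult binomial_prime_pred_cong[OF p(1)] cong_refl) auto
    also have "(- 1) ^ (k - 1) * (- 1) ^ (p - k) = (- 1 :: int) ^ (p - 1)"
      using that by (simp flip: power_add)
    also have "\<dots> = 1" using p by simp
    finally have "int p dvd int ((p - 1) choose (k - 1)) * (- 1) ^ (p - k) - 1" by (simp add: cong_iff_dvd_diff)
    then obtain c where "int ((p - 1) choose (k - 1)) * (- 1) ^ (p - k) - 1 = int p * c" by blast
    then show ?thesis by (intro exI[of _ c]) simp
  qed
  then obtain c where c: "\<And>k. k \<in> {1..<p} \<Longrightarrow> int ((p - 1) choose (k - 1)) * (- 1) ^ (p - k) = 1 + int p * c k"
    by metis
  obtain d where d: "(\<Sum>k\<in>{1..<p}. int (p choose k) * 2 ^ k * (- 1) ^ (p - k) * int ((3 * k) choose k)) = (int p)^2 * d"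
    using alternating_sum_binomial_3k_dvd[OF p] by blast
  \<comment> \<open>Here \<open>d\<close> is the alternating sum divided by the square of
    \<open>p\<close>, and the subtracted sum gathers the errors \<open>c k\<close> of the sign
    cancellation.\<close>
  define r :: rat where "r = of_int d - (\<Sum>k\<in>{1..<p}. of_int (c k) * (of_int (2 ^ k * int ((3 * k) choose k)) / of_nat k))"
  have r: "r \<in> p_integral p"
    unfolding r_def by (intro p_integral_diff p_integral_of_int p_integral_sum p_integral_mult
      p_integral_divide_of_nat p) auto
  have "of_int (int (p choose k) * 2 ^ k * (- 1) ^ (p - k) * int ((3 * k) choose k)) =
     (of_nat p * (2 ^ k * of_nat ((3 * k) choose k) / of_nat k) + of_nat p ^ 2 * (of_int (c k) *
       (of_int (2 ^ k * int ((3 * k) choose k)) / of_nat k)) :: rat)"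
    if k: "k \<in> {1..<p}" for k
  proof -
    have "of_nat k * of_nat (p choose k) = (of_nat p * of_nat ((p - 1) choose (k - 1)) :: rat)"
      using times_binomial_minus1_eq[of k p] k by (metis atLeastLessThan_iff of_nat_mult zero_less_one order_less_le_trans)
    then have 1: "of_nat (p choose k) = (of_nat p * of_nat ((p - 1) choose (k - 1)) / of_nat k :: rat)"
      using k by (simp add: field_simps)
    have 2: "of_nat ((p - 1) choose (k - 1)) * (- 1) ^ (p - k) = (1 + of_nat p * of_int (c k) :: rat)"
      using arg_cong[OF c[OF k], of "of_int :: int \<Rightarrow> rat"] by simp
    have "of_int (int (p choose k) * 2 ^ k * (- 1) ^ (p - k) * int ((3 * k) choose k)) =
      of_nat p * (of_nat ((p - 1) choose (k - 1)) * (- 1) ^ (p - k)) * (2 ^ k * of_nat ((3 * k) choose k)) / (of_nat k :: rat)"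
      by (simp add: 1)
    then show ?thesis unfolding 2 by (simp add: add_divide_distrib algebra_simps power2_eq_square)
  qed
  then have "of_int ((int p)^2 * d) = (\<Sum>k\<in>{1..<p}. of_nat p * (2 ^ k * of_nat ((3 * k) choose k) / of_nat k)
      + of_nat p ^ 2 * (of_int (c k) * (of_int (2 ^ k * int ((3 * k) choose k)) / of_nat k)) :: rat)"
    unfolding d[symmetric] of_int_sum by (intro sum.cong refl)
  then have "of_nat p * (\<Sum>k\<in>{1..<p}. 2 ^ k * of_nat ((3 * k) choose k) / of_nat k) = of_nat p * (of_nat p * r)"
    unfolding r_def sum.distrib sum_distrib_left[symmetric] by (simp add: algebra_simps power2_eq_square)
  then have "(\<Sum>k\<in>{1..<p}. 2 ^ k * of_nat ((3 * k) choose k) / of_nat k) = of_nat p * r" using p0 by simp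
  moreover have "{1..<p} = {1..p - 1}" using p0 by auto
  ultimately show ?thesis using r by auto
qed

section \<open>Passage to the two rational congruences\<close>

text \<open>Partial fractions: \<open>1 / (k * (2 * k + 1))\<close> equals
  \<open>1 / k - 2 / (2 * k + 1)\<close>.\<close>

lemma catalan2_over_k:
  assumes "k > 0"
  shows "catalan2 k / of_nat k = of_nat ((3 * k) choose k) / of_nat k - 2 * catalan2 k"
proof -
  have "(1 + 2 * of_nat k :: rat) = of_nat (1 + 2 * k)" by simp
  also have "\<dots> \<noteq> 0" by (simp only: of_nat_eq_0_iff)
  finally show ?thesis using assms by (simp add: catalan2_def divide_simps) (simp add: algebra_simps)
qed

theorem theorem1p1:
  fixes p :: nat
  assumes "prime p" and "odd p"
  shows "rat_cong p (\<Sum>k = 1..p - 1. 2 ^ k * catalan2 k)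
                    (2 * ((-1) ^ ((p - 1) div 2) - 1))
       \<and> rat_cong p (\<Sum>k = 1..p - 1. 2 ^ k * catalan2 k / of_nat k)
                    (4 * (1 - (-1) ^ ((p - 1) div 2)))"
proof -
  define \<epsilon> :: int where "\<epsilon> = (- 1) ^ ((p - 1) div 2)"
  define S where "S = (\<Sum>k = 1..p - 1. 2 ^ k * catalan2_int k)"
  have S: "(\<Sum>k = 1..p - 1. 2 ^ k * catalan2 k) = of_int S"
    by (simp add: S_def of_int_catalan2_int)
  obtain d where "S - 2 * (\<epsilon> - 1) = int p * d"
    using sum_catalan2_cong[OF assms] unfolding S_def \<epsilon>_def cong_iff_dvd_diff by blast
  from arg_cong[OF this, of "of_int :: int \<Rightarrow> rat"]
  have d: "of_int S - 2 * (of_int \<epsilon> - 1) = (of_nat p * of_int d :: rat)" by simp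
  obtain r where r: "r \<in> p_integral p"
    "(\<Sum>k = 1..p - 1. 2 ^ k * of_nat ((3 * k) choose k) / of_nat k) = of_nat p * r"
    using sum_binomial_3k_over_k[OF assms] by blast
  have "(\<Sum>k = 1..p - 1. 2 ^ k * catalan2 k / of_nat k) =
      (\<Sum>k = 1..p - 1. 2 ^ k * of_nat ((3 * k) choose k) / of_nat k - 2 * (2 ^ k * catalan2 k))"
    by (intro sum.cong refl) (simp add: catalan2_over_k right_diff_distrib flip: times_divide_eq_right)
  also have "\<dots> = of_nat p * r - 2 * of_int S"
    unfolding sum_subtractf r(2) sum_distrib_left[symmetric] S ..
  finally have T: "(\<Sum>k = 1..p - 1. 2 ^ k * catalan2 k / of_nat k) = of_nat p * r - 2 * of_int S" .
  have "rat_cong p (of_int S) (of_int (2 * (\<epsilon> - 1)))"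
    unfolding rat_cong_def using d
    by (intro conjI p_integral_of_int bexI[of _ "of_int d"]) simp_all
  moreover have "of_nat p * r - 2 * of_int S \<in> p_integral p"
    using p_integral_diff[OF p_integral_mult[OF p_integral_of_int[of "int p"] r(1)] p_integral_of_int[of "2 * S"]] by simp
  \<comment> \<open>This is the quotient for the second congruence:
    \<open>- 2 * S - 4 * (1 - \<epsilon>)\<close> is -2 times the difference
    \<open>S - 2 * (\<epsilon> - 1)\<close> from the first.\<close>
  moreover have "r - of_int (2 * d) \<in> p_integral p" by (intro p_integral_diff r p_integral_of_int)
  moreover have "of_nat p * r - 2 * of_int S - of_int (4 * (1 - \<epsilon>)) = of_nat p * (r - of_int (2 * d))"
    using d by (simp add: algebra_simps)
  ultimately have "rat_cong p (of_int S) (of_int (2 * (\<epsilon> - 1))) \<and>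
      rat_cong p (of_nat p * r - 2 * of_int S) (of_int (4 * (1 - \<epsilon>)))"
    unfolding rat_cong_def using p_integral_of_int by blast
  then show ?thesis unfolding S T by (simp add: \<epsilon>_def)
qed

end
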